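(* Let $G$ be an almost topological group with neutral element $e$. For each open neighborhood $U$ of $e$ there is a pre-continuous prenorm $N$ on $G$ such that the unit ball $B_{N}(1)=\{x\in G: N(x)<1\}$ satisfies $B_{N}(1)\subseteq U$.
   Context: A pre-topology on a set $Z$ is a family $\mathscr{T}$ of subsets of $Z$ with $\bigcup\mathscr{T}=Z$ that is closed under arbitrary unions (in particular $\emptyset\in\mathscr{T}$); it need not be closed under finite intersections. Members of $\mathscr{T}$ are called open. A map between pre-topological spaces is pre-continuous if preimages of open sets are open. For a pre-topological space $G$, the product pre-topology on $G\times G$ has as open sets exactly the unions of sets $U\times V$ with $U,V$ open in $G$. A pre-topological group is a group $G$ with a pre-topology such that the multiplication $G\times G\to G$ and the inversion $G\to G$ are pre-continuous. A pre-base at a point $z$ is a family of open sets containing $z$ such that every open set containing $z$ contains a member of the family. An almost topological group is a pre-topological group $G$ having a pre-base $\mathscr{B}_e$ at the neutral element $e$ such that $U=U^{-1}$ for each $U\in\mathscr{B}_e$ and for each $U\in\mathscr{B}_e$ there is $V\in\mathscr{B}_e$ with $V^2\subseteq U$. A prenorm on a group $G$ is a function $N:G\to\mathbb{R}$ with $N(e)=0$, $N(xy)\le N(x)+N(y)$ and $N(x^{-1})=N(x)$ for all $x,y\in G$. Pre-continuity of $N$ is with respect to the usual topology of $\mathbb{R}$. *)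

theory Defs
  imports "HOL-Algebra.Coset" Complex_Main
begin

text \<open>Closure under arbitrary unions includes the empty union, so \<open>{} \<in> \<T>\<close>;
  closure under finite intersections is not required.\<close>

definition pretopology_on :: "'a set \<Rightarrow> 'a set set \<Rightarrow> bool" where
  "pretopology_on Z \<T> \<longleftrightarrow> \<Union>\<T> = Z \<and> (\<forall>\<A>. \<A> \<subseteq> \<T> \<longrightarrow> \<Union>\<A> \<in> \<T>)"

definition pre_continuous_map ::
    "'a set \<Rightarrow> 'a set set \<Rightarrow> 'b set \<Rightarrow> 'b set set \<Rightarrow> ('a \<Rightarrow> 'b) \<Rightarrow> bool" where
  "pre_continuous_map Z \<T> W \<S> f \<longleftrightarrow>
     f \<in> Z \<rightarrow> W \<and> (\<forall>U\<in>\<S>. {z \<in> Z. f z \<in> U} \<in> \<T>)"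

definition prod_pretopology :: "'a set set \<Rightarrow> 'b set set \<Rightarrow> ('a \<times> 'b) set set" where
  "prod_pretopology \<T> \<S> = {\<Union>\<A> |\<A>. \<A> \<subseteq> {U \<times> V |U V. U \<in> \<T> \<and> V \<in> \<S>}}"

definition pre_base_at :: "'a set set \<Rightarrow> 'a \<Rightarrow> 'a set set \<Rightarrow> bool" where
  "pre_base_at \<T> z \<B> \<longleftrightarrow>
     (\<forall>B\<in>\<B>. B \<in> \<T> \<and> z \<in> B) \<and> (\<forall>U\<in>\<T>. z \<in> U \<longrightarrow> (\<exists>B\<in>\<B>. B \<subseteq> U))"

lemma pretopology_on_open: "pretopology_on UNIV {U :: 'a::topological_space set. open U}"
  unfolding pretopology_on_def by (auto intro: open_Union)

lemma pretopology_on_prod: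
  assumes "pretopology_on Z \<T>" "pretopology_on W \<S>"
  shows "pretopology_on (Z \<times> W) (prod_pretopology \<T> \<S>)"
proof -
  define R where "R = {U \<times> V |U V. U \<in> \<T> \<and> V \<in> \<S>}"
  have prod: "prod_pretopology \<T> \<S> = Union ` Pow R"
    unfolding prod_pretopology_def R_def[symmetric] by auto
  have "\<Union>\<T> = Z" "\<Union>\<S> = W"
    using assms unfolding pretopology_on_def by simp_all
  then have "\<Union>R = Z \<times> W"
    unfolding R_def by (intro equalityI subsetI) (elim UnionE, force, elim SigmaE, clarsimp, blast)
  moreover have "\<Union>(Union ` Pow R) = \<Union>R"
    by blast
  moreover have "\<Union>\<C> \<in> Union ` Pow R" if "\<C> \<subseteq> Union ` Pow R" for \<C>
  proof
    show "{A \<in> R. A \<subseteq> \<Union>\<C>} \<in> Pow R" by simp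
    show "\<Union>\<C> = \<Union>{A \<in> R. A \<subseteq> \<Union>\<C>}"
    proof (intro equalityI subsetI)
      fix x assume "x \<in> \<Union>\<C>"
      then obtain O' where O': "O' \<in> \<C>" "x \<in> O'" by (elim UnionE)
      from subsetD[OF that O'(1)] obtain \<A> where \<A>: "O' = \<Union>\<A>" "\<A> \<subseteq> R"
        by (elim imageE) simp
      from O'(2) obtain A where "A \<in> \<A>" "x \<in> A"
        unfolding \<A>(1) by (elim UnionE)
      moreover have "A \<subseteq> \<Union>\<C>" if "A \<in> \<A>"
        using Union_upper[OF that] Union_upper[OF O'(1)] unfolding \<A>(1) by (rule order_trans)
      ultimately have "A \<in> {A \<in> R. A \<subseteq> \<Union>\<C>}" and "x \<in> A"
        using \<A>(2) by (simp_all add: subsetD)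
      then show "x \<in> \<Union>{A \<in> R. A \<subseteq> \<Union>\<C>}" by (rule UnionI)
    next
      fix x assume "x \<in> \<Union>{A \<in> R. A \<subseteq> \<Union>\<C>}"
      then show "x \<in> \<Union>\<C>" by blast
    qed
  qed
  ultimately show ?thesis
    unfolding pretopology_on_def prod by simp
qed

locale pretopological_group = group G for G (structure) +
  fixes \<T> :: "'a set set"
  assumes pretopology: "pretopology_on (carrier G) \<T>"
    and mult_pre_continuous:
      "pre_continuous_map (carrier G \<times> carrier G) (prod_pretopology \<T> \<T>) (carrier G) \<T>
         (\<lambda>(x, y). x \<otimes> y)"
    and inv_pre_continuous:
      "pre_continuous_map (carrier G) \<T> (carrier G) \<T> (\<lambda>x. inv x)"

locale almost_topological_group = pretopological_group +
  assumes symmetric_pre_base: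
    "\<exists>\<B>. pre_base_at \<T> \<one> \<B> \<and>
       (\<forall>U\<in>\<B>. U = set_inv U) \<and> (\<forall>U\<in>\<B>. \<exists>V\<in>\<B>. V <#> V \<subseteq> U)"

text \<open>Only the values of a prenorm on \<open>carrier G\<close> are constrained.\<close>

definition prenorm :: "('a, 'b) monoid_scheme \<Rightarrow> ('a \<Rightarrow> real) \<Rightarrow> bool" where
  "prenorm G N \<longleftrightarrow> N \<one>\<^bsub>G\<^esub> = 0 \<and>
     (\<forall>x\<in>carrier G. \<forall>y\<in>carrier G. N (x \<otimes>\<^bsub>G\<^esub> y) \<le> N x + N y) \<and>
     (\<forall>x\<in>carrier G. N (inv\<^bsub>G\<^esub> x) = N x)"

definition unit_ball :: "('a, 'b) monoid_scheme \<Rightarrow> ('a \<Rightarrow> real) \<Rightarrow> 'a set" where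
  "unit_ball G N = {x \<in> carrier G. N x < 1}"

end

theory Submission imports Defs begin

text \<open>
  The proof follows Birkhoff and Kakutani. Halving the members of the pre-base repeatedly gives
  symmetric open neighborhoods \<open>V 1 \<supseteq> V 2 \<supseteq> \<dots>\<close> of the neutral element, inside the given set, with
  \<open>V (n+1)\<^sup>3 \<subseteq> V n\<close>; put \<open>V 0 = G\<close>. A factor taken from \<open>V n\<close> is charged \<open>2/2\<^sup>n\<close>, and \<open>N x\<close> is
  the infimum of the total charges over all ways of writing \<open>x\<close> as a finite product of such
  factors. Concatenating factorizations gives subadditivity, and reversing them gives symmetry.

  The essential point is that \<open>N\<close> does not collapse (\<open>chain_prod_in_nbhd\<close>): a product of total
  charge below \<open>2/2\<^sup>m\<close> lies in \<open>V m\<close>. Such a product is cut, around one middle factor, into two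
  pieces of at most half the charge. By induction both pieces lie in \<open>V (m+1)\<close>, and so does the
  middle factor, so the cube condition applies. For \<open>m = 1\<close> this says that the unit ball of \<open>N\<close>
  is contained in \<open>V 1\<close>.

  Intersections of two open sets need not be open, so each step has to get by with one open set
  at a time. The \<open>V n\<close> come one by one from the pre-base, and a prenorm that is small near the neutral element is pre-continuous
  (\<open>prenorm_pre_continuous\<close>), because \<open>\<bar>N (x y) - N x\<bar> \<le> N y\<close> and translates of open sets are open.
\<close>

section \<open>The prenorm of a sequence of symmetric sets\<close>

text \<open>Taking the whole group as \<open>V 0\<close> makes every element a product of one factor, so that the
  infimum below is always over a nonempty set.\<close>

locale cube_contracting_sequence = group G for G (structure) +
  fixes V :: "nat \<Rightarrow> 'a set"
  assumes whole: "V 0 = carrier G"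
    and subset_carrier: "V n \<subseteq> carrier G"
    and one_mem: "\<one> \<in> V n"
    and inv_mem: "x \<in> V n \<Longrightarrow> inv x \<in> V n"
    and cube: "\<lbrakk>x \<in> V (Suc n); y \<in> V (Suc n); z \<in> V (Suc n)\<rbrakk> \<Longrightarrow> x \<otimes> y \<otimes> z \<in> V n"
begin

lemma mem_carrier: "x \<in> V n \<Longrightarrow> x \<in> carrier G"
  using subset_carrier by blast

lemma decreasing: "m \<le> n \<Longrightarrow> V n \<subseteq> V m"
proof (rule lift_Suc_antimono_le[of V])
  show "V (Suc k) \<subseteq> V k" for k
  proof
    fix x assume "x \<in> V (Suc k)"
    then show "x \<in> V k"
      using cube[of x k \<one> \<one>] one_mem mem_carrier by auto
  qed
qed

text \<open>A chain records with each factor the index at which it is charged, since a factor lies in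
  \<open>V n\<close> for many \<open>n\<close>, possibly for all.\<close>

definition chain :: "('a \<times> nat) list \<Rightarrow> bool" where
  "chain L \<longleftrightarrow> (\<forall>(x, n) \<in> set L. x \<in> V n)"

definition chain_prod :: "('a \<times> nat) list \<Rightarrow> 'a" where
  "chain_prod L = foldr (\<lambda>(x, n) y. x \<otimes> y) L \<one>"

definition chain_cost :: "('a \<times> nat) list \<Rightarrow> real" where
  "chain_cost L = (\<Sum>(x, n)\<leftarrow>L. 2 / 2 ^ n)"

definition chain_norm :: "'a \<Rightarrow> real" where
  "chain_norm x = Inf {chain_cost L |L. chain L \<and> chain_prod L = x}"

lemma chain_simps [simp]:
  "chain []" "chain ((x, n) # L) \<longleftrightarrow> x \<in> V n \<and> chain L"
  "chain (L @ M) \<longleftrightarrow> chain L \<and> chain M"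
  by (auto simp: chain_def)

lemma chain_prod_simps [simp]:
  "chain_prod [] = \<one>" "chain_prod ((x, n) # L) = x \<otimes> chain_prod L"
  by (simp_all add: chain_prod_def)

lemma chain_cost_simps [simp]:
  "chain_cost [] = 0" "chain_cost ((x, n) # L) = 2 / 2 ^ n + chain_cost L"
  "chain_cost (L @ M) = chain_cost L + chain_cost M"
  by (simp_all add: chain_cost_def)

lemma chain_cost_nonneg: "0 \<le> chain_cost L"
  by (induction L) auto

lemma chain_prod_closed: "chain L \<Longrightarrow> chain_prod L \<in> carrier G"
  by (induction L) (auto intro!: m_closed intro: mem_carrier)

lemma chain_prod_append:
  "chain L \<Longrightarrow> chain M \<Longrightarrow> chain_prod (L @ M) = chain_prod L \<otimes> chain_prod M"
  by (induction L) (auto simp: m_assoc mem_carrier chain_prod_closed)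

lemma chain_inverse:
  assumes "chain L"
  shows "\<exists>M. chain M \<and> chain_prod M = inv (chain_prod L) \<and> chain_cost M = chain_cost L"
  using assms
proof (induction L)
  case Nil
  show ?case by (rule exI[of _ "[]"]) simp
next
  case (Cons a L)
  obtain x n where a: "a = (x, n)" by (cases a)
  with Cons obtain M where M: "chain M" "chain_prod M = inv (chain_prod L)"
      "chain_cost M = chain_cost L"
    by auto
  show ?case
    using M Cons.prems
    by (intro exI[of _ "M @ [(inv x, n)]"])
      (auto simp: a chain_prod_append inv_mem inv_mult_group mem_carrier chain_prod_closed)
qed

lemma chain_cost_split:
  assumes "L \<noteq> []" "0 \<le> t" "t \<le> chain_cost L"
  shows "\<exists>A x n C. L = A @ (x, n) # C \<and> chain_cost A \<le> t \<and> t \<le> chain_cost (A @ [(x, n)])"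
  using assms
proof (induction L arbitrary: t)
  case Nil
  then show ?case by simp
next
  case (Cons a L)
  obtain x n where a: "a = (x, n)" by (cases a)
  show ?case
  proof (cases "t \<le> 2 / 2 ^ n")
    case True
    then show ?thesis
      using Cons.prems a by (intro exI[of _ "[]"]) auto
  next
    case False
    then have "L \<noteq> []"
      using Cons.prems a by auto
    then obtain A y k C where "L = A @ (y, k) # C" "chain_cost A \<le> t - 2 / 2 ^ n"
        "t - 2 / 2 ^ n \<le> chain_cost (A @ [(y, k)])"
      using Cons.IH[of "t - 2 / 2 ^ n"] Cons.prems False a by auto
    then show ?thesis
      by (intro exI[of _ "a # A"] exI[of _ y] exI[of _ k] exI[of _ C]) (auto simp: a)
  qed
qed

text \<open>Cutting at half of the cost leaves two pieces that each cost at most half, so less than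
  \<open>2/2\<^sup>m\<^sup>+\<^sup>1\<close>. The middle factor cannot be halved, but its cost is a power of two below \<open>2/2\<^sup>m\<close>, hence at
  most \<open>2/2\<^sup>m\<^sup>+\<^sup>1\<close>; the strict inequality in the hypothesis is what gives this.\<close>

lemma chain_prod_in_nbhd:
  assumes "chain L" "chain_cost L < 2 / 2 ^ m"
  shows "chain_prod L \<in> V m"
  using assms
proof (induction L arbitrary: m rule: length_induct)
  case (1 L)
  show ?case
  proof (cases "L = []")
    case True
    then show ?thesis by (simp add: one_mem)
  next
    case False
    then obtain A x n C where L: "L = A @ (x, n) # C"
      and left: "chain_cost A \<le> chain_cost L / 2"
      and right: "chain_cost L / 2 \<le> chain_cost (A @ [(x, n)])"
      using chain_cost_split[OF False, of "chain_cost L / 2"] chain_cost_nonneg[of L]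
      by (metis field_sum_of_halves zero_le_divide_iff zero_le_numeral le_add_same_cancel1)
    have ch: "chain A" "x \<in> V n" "chain C"
      using 1(2) L by auto
    have half: "chain_cost L / 2 < 2 / 2 ^ Suc m"
      using 1(3) by (simp add: field_simps)
    have "chain_cost C \<le> chain_cost L / 2"
      using right L by auto
    then have A: "chain_prod A \<in> V (Suc m)" and C: "chain_prod C \<in> V (Suc m)"
      using 1(1) ch left half L by auto
    have "(2::real) / 2 ^ n < 2 / 2 ^ m"
      using 1(3) L chain_cost_nonneg[of A] chain_cost_nonneg[of C] by auto
    then have "(2::real) ^ m < 2 ^ n"
      by (simp add: field_simps)
    then have "Suc m \<le> n"
      by simp
    then have "x \<in> V (Suc m)"
      using decreasing ch(2) by blast
    then have "chain_prod A \<otimes> x \<otimes> chain_prod C \<in> V m"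
      using A C cube by blast
    also have "chain_prod A \<otimes> x \<otimes> chain_prod C = chain_prod L"
      using ch by (simp add: L chain_prod_append m_assoc mem_carrier chain_prod_closed)
    finally show ?thesis .
  qed
qed

lemma chain_norm_le:
  assumes "chain L" "chain_prod L = x"
  shows "chain_norm x \<le> chain_cost L"
  unfolding chain_norm_def
  by (rule cInf_lower) (use assms in \<open>auto intro!: bdd_belowI[of _ 0] chain_cost_nonneg\<close>)

lemma chain_norm_approx:
  assumes "x \<in> carrier G" "chain_norm x < r"
  obtains L where "chain L" "chain_prod L = x" "chain_cost L < r"
proof -
  let ?S = "{chain_cost L |L. chain L \<and> chain_prod L = x}"
  have "chain_cost [(x, 0)] \<in> ?S"
    using assms(1) by (intro CollectI exI[of _ "[(x, 0)]"]) (simp add: whole)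
  then have "\<exists>c\<in>?S. c < r"
    using assms(2) unfolding chain_norm_def by (intro cInf_lessD) auto
  then show ?thesis
    using that by auto
qed

lemma chain_norm_nonneg:
  assumes "x \<in> carrier G"
  shows "0 \<le> chain_norm x"
proof (rule ccontr)
  assume "\<not> 0 \<le> chain_norm x"
  then have "chain_norm x < 0"
    by simp
  then obtain L where "chain_cost L < 0"
    using chain_norm_approx[OF assms] by metis
  then show False
    using chain_cost_nonneg[of L] by simp
qed

lemma chain_norm_le_on_nbhd: "x \<in> V n \<Longrightarrow> chain_norm x \<le> 2 / 2 ^ n"
  using chain_norm_le[of "[(x, n)]" x] by (simp add: mem_carrier)

lemma chain_norm_less_imp_mem:
  assumes "x \<in> carrier G" "chain_norm x < 2 / 2 ^ n"
  shows "x \<in> V n"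
  using chain_norm_approx[OF assms] chain_prod_in_nbhd by metis

lemma prenorm_chain_norm: "prenorm G chain_norm"
  unfolding prenorm_def
proof (intro conjI ballI)
  show "chain_norm \<one> = 0"
    using chain_norm_le[of "[]" \<one>] chain_norm_nonneg[of \<one>] by simp
next
  fix x y assume xy: "x \<in> carrier G" "y \<in> carrier G"
  show "chain_norm (x \<otimes> y) \<le> chain_norm x + chain_norm y"
  proof (rule field_le_epsilon)
    fix e :: real assume "0 < e"
    then have slack: "chain_norm x < chain_norm x + e / 2" "chain_norm y < chain_norm y + e / 2"
      by simp_all
    obtain L where "chain L" "chain_prod L = x" "chain_cost L < chain_norm x + e / 2"
      using chain_norm_approx[OF xy(1) slack(1)] by blast
    moreover obtain M where "chain M" "chain_prod M = y" "chain_cost M < chain_norm y + e / 2"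
      using chain_norm_approx[OF xy(2) slack(2)] by blast
    ultimately show "chain_norm (x \<otimes> y) \<le> chain_norm x + chain_norm y + e"
      using chain_norm_le[of "L @ M" "x \<otimes> y"] by (simp add: chain_prod_append)
  qed
next
  have le: "chain_norm (inv x) \<le> chain_norm x" if x: "x \<in> carrier G" for x
  proof (rule field_le_epsilon)
    fix e :: real assume "0 < e"
    then obtain L where "chain L" "chain_prod L = x" "chain_cost L < chain_norm x + e"
      using chain_norm_approx[OF x, of "chain_norm x + e"] by auto
    then show "chain_norm (inv x) \<le> chain_norm x + e"
      using chain_inverse[of L] chain_norm_le by force
  qed
  show "chain_norm (inv x) = chain_norm x" if x: "x \<in> carrier G" for x
    using le[OF x] le[of "inv x"] x by simp
qed

end

section \<open>Pre-continuity of prenorms\<close>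

context pretopological_group
begin

lemma open_Union_pretopology: "\<A> \<subseteq> \<T> \<Longrightarrow> \<Union>\<A> \<in> \<T>"
  using pretopology unfolding pretopology_on_def by blast

lemma open_subset_carrier: "W \<in> \<T> \<Longrightarrow> W \<subseteq> carrier G"
  using pretopology unfolding pretopology_on_def by blast

text \<open>The set is a slice of the preimage of \<open>W\<close> under multiplication. The preimage is a union of open
  rectangles \<open>A \<times> B\<close>, so the slice over \<open>a\<close> is the union of the sides \<open>B\<close> with \<open>a \<in> A\<close>.\<close>

lemma open_left_translation_vimage:
  assumes W: "W \<in> \<T>" and a: "a \<in> carrier G"
  shows "{y \<in> carrier G. a \<otimes> y \<in> W} \<in> \<T>"
proof -
  have "{z \<in> carrier G \<times> carrier G. (\<lambda>(x, y). x \<otimes> y) z \<in> W} \<in> prod_pretopology \<T> \<T>"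
    using mult_pre_continuous W unfolding pre_continuous_map_def by blast
  then obtain \<A> where \<A>: "\<A> \<subseteq> {U \<times> V |U V. U \<in> \<T> \<and> V \<in> \<T>}"
    and eq: "{z \<in> carrier G \<times> carrier G. (\<lambda>(x, y). x \<otimes> y) z \<in> W} = \<Union>\<A>"
    unfolding prod_pretopology_def by auto
  have "{y \<in> carrier G. a \<otimes> y \<in> W} = {y. (a, y) \<in> \<Union>\<A>}"
    unfolding eq[symmetric] using a by auto
  also have "\<dots> = \<Union>{B \<in> \<T>. \<exists>A. a \<in> A \<and> A \<times> B \<in> \<A>}"
    using \<A> by blast
  also have "\<dots> \<in> \<T>"
    by (rule open_Union_pretopology) blast
  finally show ?thesis .
qed

lemma prenorm_diff_le:
  assumes N: "prenorm G N" and x: "x \<in> carrier G" and y: "y \<in> carrier G"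
  shows "\<bar>N y - N x\<bar> \<le> N (inv x \<otimes> y)"
proof -
  let ?d = "inv x \<otimes> y"
  have d: "?d \<in> carrier G" using x y by simp
  have "N (x \<otimes> ?d) \<le> N x + N ?d" "N (y \<otimes> inv ?d) \<le> N y + N (inv ?d)" "N (inv ?d) = N ?d"
    using N x y d unfolding prenorm_def by blast+
  moreover have "x \<otimes> ?d = y"
    using x y by (simp add: m_assoc[symmetric])
  moreover have "y \<otimes> inv ?d = x"
    using x y by (simp add: inv_mult_group m_assoc[symmetric])
  ultimately show ?thesis by simp
qed

lemma prenorm_pre_continuous:
  assumes N: "prenorm G N"
    and small: "\<And>\<epsilon>. 0 < \<epsilon> \<Longrightarrow> \<exists>W\<in>\<T>. \<one> \<in> W \<and> (\<forall>x\<in>W. N x < \<epsilon>)"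
  shows "pre_continuous_map (carrier G) \<T> UNIV {V. open V} N"
  unfolding pre_continuous_map_def
proof (intro conjI ballI)
  show "N \<in> carrier G \<rightarrow> UNIV" by simp
next
  fix S :: "real set" assume "S \<in> {V. open V}"
  then have S: "open S" by simp
  let ?P = "{z \<in> carrier G. N z \<in> S}"
  have nbhd: "\<exists>W\<in>\<T>. x \<in> W \<and> W \<subseteq> ?P" if x: "x \<in> carrier G" "N x \<in> S" for x
  proof -
    obtain \<epsilon> where \<epsilon>: "0 < \<epsilon>" "\<And>r. \<bar>r - N x\<bar> < \<epsilon> \<Longrightarrow> r \<in> S"
      using S x(2) unfolding open_dist dist_real_def by blast
    obtain W where W: "W \<in> \<T>" "\<one> \<in> W" "\<And>z. z \<in> W \<Longrightarrow> N z < \<epsilon>"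
      using small[OF \<epsilon>(1)] by blast
    \<comment> \<open>This is the translate \<open>x W\<close>.\<close>
    let ?W = "{y \<in> carrier G. inv x \<otimes> y \<in> W}"
    have "?W \<in> \<T>"
      using open_left_translation_vimage W(1) x(1) by simp
    moreover have "x \<in> ?W"
      using x(1) W(2) by simp
    moreover have "?W \<subseteq> ?P"
    proof
      fix y assume "y \<in> ?W"
      then have y: "y \<in> carrier G" and "inv x \<otimes> y \<in> W" by simp_all
      then have "\<bar>N y - N x\<bar> < \<epsilon>"
        using prenorm_diff_le[OF N x(1) y] W(3) by (meson le_less_trans)
      then show "y \<in> ?P"
        using y \<epsilon>(2) by simp
    qed
    ultimately show ?thesis by (intro bexI[of _ ?W] conjI)
  qed
  have "?P = \<Union>{W \<in> \<T>. W \<subseteq> ?P}"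
    using nbhd by blast
  also have "\<dots> \<in> \<T>"
    by (rule open_Union_pretopology) blast
  finally show "?P \<in> \<T>" .
qed

end

section \<open>Contracting sequences of neighborhoods\<close>

context almost_topological_group
begin

text \<open>Two halvings give \<open>W\<^sup>4 \<subseteq> U\<close>, and \<open>W\<^sup>3 \<subseteq> W\<^sup>4\<close> because \<open>W\<close> contains the neutral element.\<close>

lemma ex_cube_contracting_sequence:
  assumes "U \<in> \<T>" "\<one> \<in> U"
  shows "\<exists>V. cube_contracting_sequence G V \<and> (\<forall>n. V n \<in> \<T>) \<and> V 1 \<subseteq> U"
proof -
  obtain \<B> where "pre_base_at \<T> \<one> \<B> \<and>
      (\<forall>W\<in>\<B>. W = set_inv W) \<and> (\<forall>W\<in>\<B>. \<exists>V\<in>\<B>. V <#> V \<subseteq> W)"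
    using symmetric_pre_base by (rule exE)
  then have pb: "pre_base_at \<T> \<one> \<B>"
    and sym: "\<And>W. W \<in> \<B> \<Longrightarrow> W = set_inv W"
    and sq: "\<And>W. W \<in> \<B> \<Longrightarrow> \<exists>V\<in>\<B>. V <#> V \<subseteq> W"
    by simp_all
  have \<B>: "B \<in> \<T>" "\<one> \<in> B" "B \<subseteq> carrier G" if "B \<in> \<B>" for B
    using pb that open_subset_carrier unfolding pre_base_at_def by blast+
  obtain B0 where B0: "B0 \<in> \<B>" "B0 \<subseteq> U"
    using pb assms unfolding pre_base_at_def by blast
  have third: "\<exists>W\<in>\<B>. \<forall>x\<in>W. \<forall>y\<in>W. \<forall>z\<in>W. x \<otimes> y \<otimes> z \<in> B" if B: "B \<in> \<B>" for B
  proof -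
    obtain V where V: "V \<in> \<B>" "V <#> V \<subseteq> B" using sq[OF B] by blast
    obtain W where W: "W \<in> \<B>" "W <#> W \<subseteq> V" using sq[OF V(1)] by blast
    have mulV: "x \<otimes> y \<in> B" if "x \<in> V" "y \<in> V" for x y
      using V(2) that unfolding set_mult_def by blast
    have mulW: "x \<otimes> y \<in> V" if "x \<in> W" "y \<in> W" for x y
      using W(2) that unfolding set_mult_def by blast
    have "x \<otimes> y \<otimes> z \<in> B" if "x \<in> W" "y \<in> W" "z \<in> W" for x y z
    proof -
      have "z \<in> carrier G"
        using that \<B>(3)[OF W(1)] by blast
      then have "z \<in> V"
        using mulW[of z \<one>] that \<B>(2)[OF W(1)] by simp
      then show ?thesis
        using mulV mulW that by blast
    qed
    then show ?thesis using W(1) by blast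
  qed
  have "\<exists>F. \<forall>n. (F n \<in> \<B> \<and> (n = 0 \<longrightarrow> F n = B0)) \<and>
      (\<forall>x\<in>F (Suc n). \<forall>y\<in>F (Suc n). \<forall>z\<in>F (Suc n). x \<otimes> y \<otimes> z \<in> F n)"
    by (rule dependent_nat_choice[where
          P = "\<lambda>n W. W \<in> \<B> \<and> (n = 0 \<longrightarrow> W = B0)" and
          Q = "\<lambda>n B W. \<forall>x\<in>W. \<forall>y\<in>W. \<forall>z\<in>W. x \<otimes> y \<otimes> z \<in> B"])
      (use B0 third[unfolded Bex_def] in auto)
  then obtain F where F: "\<And>n. F n \<in> \<B>" "F 0 = B0"
    and cube: "\<And>n x y z. \<lbrakk>x \<in> F (Suc n); y \<in> F (Suc n); z \<in> F (Suc n)\<rbrakk> \<Longrightarrow> x \<otimes> y \<otimes> z \<in> F n"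
    by blast
  have inv_F: "inv x \<in> F n" if "x \<in> F n" for x n
    using sym[OF F(1)[of n]] that unfolding SET_INV_def by blast
  define V where "V = case_nat (carrier G) F"
  have "cube_contracting_sequence G V"
  proof
    show "V 0 = carrier G" by (simp add: V_def)
    show "V n \<subseteq> carrier G" and "\<one> \<in> V n" for n
      using \<B> F(1) by (cases n; simp add: V_def)+
    show "inv x \<in> V n" if "x \<in> V n" for x n
      using that inv_F by (cases n) (auto simp: V_def)
    show "x \<otimes> y \<otimes> z \<in> V n" if "x \<in> V (Suc n)" "y \<in> V (Suc n)" "z \<in> V (Suc n)" for x y z n
    proof (cases n)
      case 0
      then show ?thesis
        using that subsetD[OF \<B>(3)[OF F(1)[of 0]]] by (simp add: V_def)
    next
      case (Suc k)
      then show ?thesis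
        using that cube by (simp add: V_def)
    qed
  qed
  moreover have "carrier G \<in> \<T>"
    using pretopology open_Union_pretopology[of \<T>] by (simp add: pretopology_on_def)
  then have "V n \<in> \<T>" for n
    using \<B>(1) F(1) by (cases n) (simp_all add: V_def)
  moreover have "V 1 \<subseteq> U"
    using B0 F(2) by (simp add: V_def)
  ultimately show ?thesis by blast
qed

end

theorem theorem6p5:
  fixes G (structure) and \<T> :: "'a set set" and U :: "'a set"
  assumes "almost_topological_group G \<T>"
    and "U \<in> \<T>" and "\<one> \<in> U"
  shows "\<exists>N. prenorm G N \<and>
           pre_continuous_map (carrier G) \<T> (UNIV :: real set) {V. open V} N \<and>
           unit_ball G N \<subseteq> U"
proof -
  interpret almost_topological_group G \<T> by fact
  obtain V where V: "cube_contracting_sequence G V" "\<And>n. V n \<in> \<T>" "V 1 \<subseteq> U"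
    using ex_cube_contracting_sequence assms(2,3) by blast
  interpret cube_contracting_sequence G V by fact
  have "\<exists>W\<in>\<T>. \<one> \<in> W \<and> (\<forall>x\<in>W. chain_norm x < \<epsilon>)" if \<epsilon>: "0 < \<epsilon>" for \<epsilon> :: real
  proof -
    obtain n where "(1 / 2 :: real) ^ n < \<epsilon> / 2"
      using real_arch_pow_inv[of "\<epsilon> / 2" "1 / 2 :: real"] half_gt_zero[OF \<epsilon>] by fastforce
    then have "2 / 2 ^ n < \<epsilon>"
      by (simp add: power_one_over field_simps)
    then show ?thesis
      using V(2) one_mem chain_norm_le_on_nbhd by (meson le_less_trans)
  qed
  then have "pre_continuous_map (carrier G) \<T> UNIV {V. open V} chain_norm"
    by (rule prenorm_pre_continuous[OF prenorm_chain_norm])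
  moreover have "unit_ball G chain_norm \<subseteq> U"
    using chain_norm_less_imp_mem[of _ 1] V(3) by (auto simp: unit_ball_def)
  ultimately show ?thesis
    using prenorm_chain_norm by blast
qed

end
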